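(* Let $r\ge2$ be even and let $T\in S^r(\mathbb{R}^d)$ be a reflectionally invariant tensor. Let $l=(r-2)/2$ and suppose in addition that $$\sum_{i_1,\dots,i_l=1}^d T_{i_1i_1\cdots i_li_ljj}\neq\sum_{i_1,\dots,i_l=1}^d T_{i_1i_1\cdots i_li_lkk}\qquad\text{for all }j\neq k.$$ Then for $Q\in\mathrm{O}(d)$, the tensor $Q\bullet T$ is reflectionally invariant if and only if $Q\in\mathrm{SP}(d)$; that is, $\{Q\in\mathrm{O}(d):Q\bullet T\in\mathcal{V}^{\rm refl}\}=\mathrm{SP}(d)$.
   Context: $S^r(\mathbb{R}^d)$ is the space of real symmetric $d\times\cdots\times d$ tensors of order $r$. For $A\in\mathbb{R}^{d\times d}$, $(A\bullet T)_{i_1\cdots i_r}=\sum_{j_1,\dots,j_r=1}^d A_{i_1j_1}\cdots A_{i_rj_r}T_{j_1\cdots j_r}$. A tensor $T\in S^r(\mathbb{R}^d)$ is reflectionally invariant if $T_{i_1\cdots i_r}=0$ unless each index value appears in $(i_1,\dots,i_r)$ an even number of times; $\mathcal{V}^{\rm refl}\subset S^r(\mathbb{R}^d)$ is the set of these tensors. $\mathrm{O}(d)$ is the group of real orthogonal $d\times d$ matrices; $\mathrm{SP}(d)$ is the set of $d\times d$ signed permutation matrices, i.e. matrices $DP$ with $D$ diagonal with $\pm1$ diagonal entries and $P$ a permutation matrix. (For $r=2$, $l=0$ and the condition reads $T_{jj}\neq T_{kk}$ for $j\ne k$.) *)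

theory Defs
  imports "HOL-Analysis.Analysis"
begin

text \<open>
  \<open>\<real>\<^sup>d\<close> is \<^typ>\<open>real ^ 'n\<close> with \<open>d = CARD('n)\<close>. An order-\<open>r\<close> tensor is a function on
  multi-indices, i.e. on the lists of length \<open>r\<close> over \<^typ>\<open>'n\<close>; it is set to \<open>0\<close> on lists of
  any other length, so that equality of functions is equality of tensors.
\<close>

definition multi_indices :: "nat \<Rightarrow> 'n::finite list set" where
  "multi_indices r = {is. length is = r}"

definition sym_tensors :: "nat \<Rightarrow> ('n::finite list \<Rightarrow> real) set" where
  "sym_tensors r =
     {T. (\<forall>is. is \<notin> multi_indices r \<longrightarrow> T is = 0) \<and>
         (\<forall>is\<in>multi_indices r. \<forall>p. p permutes {..<r} \<longrightarrow>
            T (map (\<lambda>k. is ! p k) [0..<r]) = T is)}"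

text \<open>The order is read off from the multi-index; an order-\<open>r\<close> tensor is sent to one again.\<close>

definition tensor_act :: "real ^ 'n ^ 'n \<Rightarrow> ('n::finite list \<Rightarrow> real) \<Rightarrow> 'n list \<Rightarrow> real" where
  "tensor_act A T is =
     (\<Sum>js\<in>multi_indices (length is). (\<Prod>k<length is. A $ (is ! k) $ (js ! k)) * T js)"

definition V_refl :: "nat \<Rightarrow> ('n::finite list \<Rightarrow> real) set" where
  "V_refl r =
     {T \<in> sym_tensors r.
        \<forall>is\<in>multi_indices r. \<not> (\<forall>a. even (count_list is a)) \<longrightarrow> T is = 0}"

text \<open>\<open>T\<^bsub>i\<^sub>1i\<^sub>1\<dots>i\<^sub>li\<^sub>ljj\<^esub>\<close> summed over \<open>i\<^sub>1,\<dots>,i\<^sub>l\<close>.\<close>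

definition contracted_diag :: "nat \<Rightarrow> ('n::finite list \<Rightarrow> real) \<Rightarrow> 'n \<Rightarrow> real" where
  "contracted_diag l T j =
     (\<Sum>is\<in>multi_indices l. T (concat (map (\<lambda>i. [i, i]) is) @ [j, j]))"

definition orthogonal_group :: "(real ^ 'n ^ 'n) set" where
  "orthogonal_group = {Q. orthogonal_matrix Q}"

definition sign_diagonal_matrix :: "real ^ 'n ^ 'n \<Rightarrow> bool" where
  "sign_diagonal_matrix D \<longleftrightarrow>
     (\<forall>i. D $ i $ i = 1 \<or> D $ i $ i = -1) \<and> (\<forall>i j. i \<noteq> j \<longrightarrow> D $ i $ j = 0)"

definition permutation_matrix :: "real ^ 'n ^ 'n \<Rightarrow> bool" where
  "permutation_matrix P \<longleftrightarrow>
     (\<exists>p. p permutes UNIV \<and> P = (\<chi> i j. if j = p i then 1 else 0))"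

definition signed_permutation_matrices :: "(real ^ 'n ^ 'n) set" where
  "signed_permutation_matrices =
     {D ** P | D P. sign_diagonal_matrix D \<and> permutation_matrix P}"

end

(* Contracting the index pairs i_1 i_1 ... i_l i_l commutes with the action of O(d) and turns T
   into a d x d matrix M(T) with M(Q T) = Q M(T) Q^T.  If T and Q T are reflectionally invariant,
   both matrices are diagonal, so Q_{jk} (M(T)_{kk} - M(Q T)_{jj}) = 0.  The entries M(T)_{kk} are
   pairwise distinct, so every row of Q has at most one nonzero entry. *)
theory Submission
  imports Defs
begin

section \<open>Multi-indices and the tensor action, one index at a time\<close>

lemma finite_multi_indices [simp]: "finite (multi_indices r :: 'n::finite list set)"
  using finite_lists_length_eq[of "UNIV :: 'n set" r] by (simp add: multi_indices_def)

lemma multi_indices_0 [simp]: "multi_indices 0 = {[]}"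
  by (auto simp: multi_indices_def)

lemma sum_multi_indices_Suc:
  fixes f :: "'n::finite list \<Rightarrow> 'b::comm_monoid_add"
  shows "sum f (multi_indices (Suc r)) = (\<Sum>i\<in>UNIV. \<Sum>is\<in>multi_indices r. f (i # is))"
proof -
  have "multi_indices (Suc r) = (\<lambda>(i, is). i # is) ` ((UNIV :: 'n set) \<times> multi_indices r)"
    by (auto simp: multi_indices_def length_Suc_conv image_iff)
  moreover have "inj_on (\<lambda>(i, is). i # is) ((UNIV :: 'n set) \<times> multi_indices r)"
    by (auto simp: inj_on_def)
  ultimately show ?thesis
    by (simp add: sum.reindex sum.cartesian_product case_prod_unfold comp_def)
qed

lemma tensor_act_Nil [simp]: "tensor_act A T [] = T []"
  by (simp add: tensor_act_def)

text \<open>Splitting off the first index makes the action recursive along the list; every later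
  computation with it unfolds this rule.\<close>

lemma tensor_act_Cons:
  "tensor_act A T (i # is) = (\<Sum>j\<in>UNIV. A $ i $ j * tensor_act A (\<lambda>js. T (j # js)) is)"
  by (simp add: tensor_act_def sum_multi_indices_Suc prod.lessThan_Suc_shift sum_distrib_left
      mult.assoc del: prod.lessThan_Suc)

lemma tensor_act_sum:
  "tensor_act A (\<lambda>js. \<Sum>x\<in>X. F x js) is = (\<Sum>x\<in>X. tensor_act A (F x) is)"
  unfolding tensor_act_def sum_distrib_left by (rule sum.swap)

section \<open>Orthogonality in coordinates and contraction of index pairs\<close>

lemma orthogonal_matrix_sum_rows:
  fixes Q :: "real ^ 'n ^ 'n"
  shows "orthogonal_matrix Q \<longleftrightarrow>
    (\<forall>i j. (\<Sum>k\<in>UNIV. Q $ i $ k * Q $ j $ k) = (if i = j then 1 else 0))"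
proof -
  have "orthogonal_matrix Q \<longleftrightarrow> Q ** transpose Q = mat 1"
    by (metis orthogonal_matrix_def matrix_left_right_inverse)
  then show ?thesis
    by (simp add: vec_eq_iff matrix_matrix_mult_def transpose_def mat_def)
qed

lemma orthogonal_matrix_sum_cols:
  fixes Q :: "real ^ 'n ^ 'n"
  assumes "orthogonal_matrix Q"
  shows "(\<Sum>k\<in>UNIV. Q $ k $ i * Q $ k $ j) = (if i = j then 1 else 0)"
  using assms orthogonal_matrix_transpose[of Q] orthogonal_matrix_sum_rows[of "transpose Q"]
  by (simp add: transpose_def)

text \<open>At \<open>[j, j]\<close> this is \<open>contracted_diag l T j\<close>. The free tail
  \<open>ks\<close> makes the contraction a tensor again, on which \<open>Q\<close> can act, and
  gives access to the off-diagonal entries.\<close>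

definition contract_pairs :: "nat \<Rightarrow> ('n::finite list \<Rightarrow> real) \<Rightarrow> 'n list \<Rightarrow> real" where
  "contract_pairs l T ks = (\<Sum>is\<in>multi_indices l. T (concat (map (\<lambda>i. [i, i]) is) @ ks))"

lemma contract_pairs_0 [simp]: "contract_pairs 0 T = T"
  by (simp add: contract_pairs_def fun_eq_iff)

lemma contract_pairs_Suc:
  "contract_pairs (Suc l) T = contract_pairs l (\<lambda>js. \<Sum>i\<in>UNIV. T (i # i # js))"
  unfolding contract_pairs_def sum_multi_indices_Suc
  by (rule ext, subst sum.swap) simp

text \<open>Expanding the two leading indices leaves the factor
  \<open>\<Sum>i. Q $ i $ a * Q $ i $ b\<close>; the columns of \<open>Q\<close> are orthonormal, so
  only \<open>a = b\<close> survives.\<close>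

lemma tensor_act_contract_pair:
  assumes "orthogonal_matrix Q"
  shows "(\<Sum>i\<in>UNIV. tensor_act Q T (i # i # is))
    = tensor_act Q (\<lambda>js. \<Sum>i\<in>UNIV. T (i # i # js)) is"
proof -
  let ?F = "\<lambda>a b. tensor_act Q (\<lambda>js. T (a # b # js)) is"
  have "(\<Sum>i\<in>UNIV. tensor_act Q T (i # i # is))
      = (\<Sum>i\<in>UNIV. \<Sum>a\<in>UNIV. \<Sum>b\<in>UNIV. Q $ i $ a * Q $ i $ b * ?F a b)"
    by (simp add: tensor_act_Cons sum_distrib_left mult.assoc)
  also have "\<dots> = (\<Sum>a\<in>UNIV. \<Sum>i\<in>UNIV. \<Sum>b\<in>UNIV. Q $ i $ a * Q $ i $ b * ?F a b)"
    by (rule sum.swap)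
  also have "\<dots> = (\<Sum>a\<in>UNIV. \<Sum>b\<in>UNIV. \<Sum>i\<in>UNIV. Q $ i $ a * Q $ i $ b * ?F a b)"
    by (intro sum.cong refl sum.swap)
  also have "\<dots> = (\<Sum>a\<in>UNIV. \<Sum>b\<in>UNIV. (if a = b then 1 else 0) * ?F a b)"
    by (simp only: sum_distrib_right[symmetric] orthogonal_matrix_sum_cols[OF assms])
  also have "\<dots> = (\<Sum>a\<in>UNIV. ?F a a)"
    by (simp add: if_distrib[of "\<lambda>x. x * _"] cong: if_cong)
  finally show ?thesis
    by (simp add: tensor_act_sum)
qed

text \<open>\<open>T\<close> is generalized because each induction step replaces it by its
  contraction in the leading pair.\<close>

lemma contract_pairs_tensor_act:
  assumes "orthogonal_matrix Q"
  shows "contract_pairs l (tensor_act Q T) = tensor_act Q (contract_pairs l T)"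
  by (induction l arbitrary: T)
    (simp_all add: contract_pairs_Suc tensor_act_contract_pair[OF assms])

lemma even_count_list_concat_pairs: "even (count_list (concat (map (\<lambda>i. [i, i]) is)) a)"
  by (induction "is") auto

text \<open>Each summand vanishes by itself: the pairs contribute an even number of copies of
  \<open>j\<close>, and the tail exactly one more.\<close>

lemma contract_pairs_off_diagonal:
  assumes "T \<in> V_refl (2 * l + 2)" and "j \<noteq> k"
  shows "contract_pairs l T [j, k] = 0"
  unfolding contract_pairs_def
proof (rule sum.neutral, rule ballI)
  fix "is" :: "'a list"
  assume len: "is \<in> multi_indices l"
  let ?js = "concat (map (\<lambda>i. [i, i]) is) @ [j, k]"
  have "length (concat (map (\<lambda>i. [i, i]) is)) = 2 * length is"
    by (induction "is") auto
  then have "?js \<in> multi_indices (2 * l + 2)"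
    using len by (simp add: multi_indices_def)
  moreover have "odd (count_list ?js j)"
    using assms(2) even_count_list_concat_pairs[of "is" j] by simp
  ultimately show "T ?js = 0"
    using assms(1) unfolding V_refl_def by blast
qed

section \<open>Signed permutation matrices in monomial form, and their action on tensors\<close>

lemma signed_permutation_matrices_iff:
  "Q \<in> signed_permutation_matrices \<longleftrightarrow>
    (\<exists>p s. bij p \<and> (\<forall>i. s i = 1 \<or> s i = -1) \<and>
           (\<forall>i j. Q $ i $ j = (if j = p i then s i else 0)))"
  (is "?L \<longleftrightarrow> ?R")
proof
  assume ?L
  then obtain D P p where Q: "Q = D ** P" and D: "sign_diagonal_matrix D"
    and p: "p permutes UNIV" and P: "P = (\<chi> i j. if j = p i then 1 else 0)"
    by (auto simp: signed_permutation_matrices_def permutation_matrix_def)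
  have "Q $ i $ j = (if j = p i then D $ i $ i else 0)" for i j
  proof -
    have "Q $ i $ j = (\<Sum>k\<in>UNIV. D $ i $ k * P $ k $ j)"
      by (simp add: Q matrix_matrix_mult_def)
    also have "\<dots> = (\<Sum>k\<in>UNIV. if k = i then D $ i $ i * P $ i $ j else 0)"
      using D by (intro sum.cong) (auto simp: sign_diagonal_matrix_def)
    finally show ?thesis by (simp add: P)
  qed
  then show ?R
    using D permutes_bij[OF p] by (intro exI[of _ p] exI[of _ "\<lambda>i. D $ i $ i"])
      (simp add: sign_diagonal_matrix_def)
next
  assume ?R
  then obtain p s where p: "bij p" and s: "\<forall>i. s i = 1 \<or> s i = -1"
    and Q: "\<And>i j. Q $ i $ j = (if j = p i then s i else 0)"
    by blast
  define D :: "real ^ 'a ^ 'a" where "D = (\<chi> i j. if i = j then s i else 0)"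
  define P :: "real ^ 'a ^ 'a" where "P = (\<chi> i j. if j = p i then 1 else 0)"
  have "p permutes UNIV"
    using p by (intro bij_imp_permutes) simp_all
  then have "permutation_matrix P"
    unfolding permutation_matrix_def P_def by blast
  moreover have "sign_diagonal_matrix D"
    using s by (simp add: sign_diagonal_matrix_def D_def)
  moreover have "Q = D ** P"
    by (simp add: vec_eq_iff matrix_matrix_mult_def D_def P_def Q
        if_distrib[of "\<lambda>x. x * _"] cong: if_cong)
  ultimately show ?L
    unfolding signed_permutation_matrices_def by blast
qed

lemma signed_permutation_matrices_subset_orthogonal:
  "signed_permutation_matrices \<subseteq> orthogonal_group"
proof
  fix Q :: "real ^ 'n ^ 'n"
  assume "Q \<in> signed_permutation_matrices"
  then obtain p s where p: "bij p" and s: "\<forall>i. s i = 1 \<or> s i = -1"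
    and Q: "\<And>i j. Q $ i $ j = (if j = p i then s i else 0)"
    unfolding signed_permutation_matrices_iff by blast
  have "(\<Sum>k\<in>UNIV. Q $ i $ k * Q $ j $ k) = (if i = j then 1 else 0)" for i j
  proof -
    \<comment> \<open>Rows \<open>i\<close> and \<open>j\<close> are supported in the single columns
      \<open>p i\<close> and \<open>p j\<close>.\<close>
    have "(\<Sum>k\<in>UNIV. Q $ i $ k * Q $ j $ k) = (if p i = p j then s i * s j else 0)"
      by (simp add: Q if_distrib[of "\<lambda>x. x * _"] cong: if_cong)
    also have "\<dots> = (if i = j then 1 else 0)"
      using s[rule_format, of i] bij_is_inj[OF p] by (auto simp: inj_eq)
    finally show ?thesis .
  qed
  then show "Q \<in> orthogonal_group"
    by (simp add: orthogonal_group_def orthogonal_matrix_sum_rows)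
qed

text \<open>Each row sum in \<open>tensor_act_Cons\<close> has one surviving term, so the action
  only relabels the indices by \<open>p\<close> and collects the factors \<open>s\<close>.\<close>

lemma tensor_act_monomial:
  assumes "\<And>i j. A $ i $ j = (if j = p i then s i else 0)"
  shows "tensor_act A T is = prod_list (map s is) * T (map p is)"
  by (induction "is" arbitrary: T)
    (simp_all add: tensor_act_Cons assms if_distrib[of "\<lambda>x. x * _"] mult.assoc cong: if_cong)

lemma tensor_act_signed_permutation_V_refl:
  assumes Q: "Q \<in> signed_permutation_matrices" and T: "T \<in> V_refl r"
  shows "tensor_act Q T \<in> V_refl r"
proof -
  obtain p s where p: "bij p"
    and Q: "\<And>i j. Q $ i $ j = (if j = p i then s i else 0)"
    using Q unfolding signed_permutation_matrices_iff by blast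
  note act = tensor_act_monomial[of Q p s T, OF Q]
  have T0: "T is = 0" if "is \<notin> multi_indices r" for "is"
    using T that by (simp add: V_refl_def sym_tensors_def)
  have Tsym: "T (permute_list q is) = T is" if "is \<in> multi_indices r" "q permutes {..<r}" for "is" q
    using T that by (simp add: V_refl_def sym_tensors_def permute_list_def multi_indices_def)
  have Trefl: "T is = 0" if "is \<in> multi_indices r" "odd (count_list is a)" for "is" a
    using T that unfolding V_refl_def by blast
  have map_p: "map p is \<in> multi_indices r \<longleftrightarrow> is \<in> multi_indices r" for "is"
    by (simp add: multi_indices_def)
  have "tensor_act Q T (map (\<lambda>k. is ! q k) [0..<r]) = tensor_act Q T is"
    if I: "is \<in> multi_indices r" and q: "q permutes {..<r}" for "is" q
  proof -
    have len: "length is = r" using I by (simp add: multi_indices_def)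
    \<comment> \<open>The product depends only on the multiset of indices.\<close>
    have "prod_list (map s (permute_list q is)) = prod_list (map s is)"
      using q len by (metis mset_map mset_permute_list prod_mset_prod_list)
    moreover have "T (map p (permute_list q is)) = T (map p is)"
      using q len Tsym[of "map p is" q] I map_p by (simp add: permute_list_map)
    ultimately show ?thesis
      using len by (simp add: act permute_list_def)
  qed
  moreover have "tensor_act Q T is = 0"
    if "is \<in> multi_indices r" and a: "odd (count_list is a)" for "is" a
  proof -
    \<comment> \<open>Relabelling by the injective \<open>p\<close> preserves multiplicities, hence
      their parity.\<close>
    have "count_list (map p is) (p a) = count_list is a"
      using bij_is_inj[OF p] by (induction "is") (simp_all add: inj_eq)
    then show ?thesis
      using Trefl[of "map p is" "p a"] that by (simp add: act map_p)
  qed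
  ultimately show ?thesis
    unfolding V_refl_def sym_tensors_def by (auto simp: act T0 map_p)
qed

text \<open>The assumption \<open>diag\<close> says that Q diag(d) Q^T = diag(d'). Hence Q diag(d) =
  diag(d') Q, and two nonzero entries in one row of \<open>Q\<close> would force two equal values of
  \<open>d\<close>.\<close>

lemma orthogonal_conj_diagonal_imp_signed_permutation:
  fixes Q :: "real ^ 'n ^ 'n" and d d' :: "'n \<Rightarrow> real"
  assumes Q: "orthogonal_matrix Q" and "inj d"
    and diag: "\<And>i j. (\<Sum>a\<in>UNIV. Q $ i $ a * Q $ j $ a * d a) = (if i = j then d' i else 0)"
  shows "Q \<in> signed_permutation_matrices"
proof -
  \<comment> \<open>Multiply \<open>diag\<close> by \<open>Q\<close> on the right and use Q^T Q =
    1.\<close>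
  have eq: "Q $ i $ b * d b = d' i * Q $ i $ b" for i b
  proof -
    have "d' i * Q $ i $ b
        = (\<Sum>j\<in>UNIV. (\<Sum>a\<in>UNIV. Q $ i $ a * Q $ j $ a * d a) * Q $ j $ b)"
      by (simp add: diag if_distrib[of "\<lambda>x. x * _"] cong: if_cong)
    also have "\<dots> = (\<Sum>a\<in>UNIV. \<Sum>j\<in>UNIV. Q $ i $ a * d a * (Q $ j $ a * Q $ j $ b))"
      unfolding sum_distrib_right by (subst sum.swap) (simp add: mult_ac)
    also have "\<dots> = (\<Sum>a\<in>UNIV. Q $ i $ a * d a * (if a = b then 1 else 0))"
      by (simp only: sum_distrib_left[symmetric] orthogonal_matrix_sum_cols[OF Q])
    also have "\<dots> = Q $ i $ b * d b"
      by (simp add: if_distrib[of "\<lambda>x. _ * x"] cong: if_cong)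
    finally show ?thesis ..
  qed
  have rows: "(\<Sum>k\<in>UNIV. Q $ i $ k * Q $ j $ k) = (if i = j then 1 else 0)" for i j
    by (rule Q[unfolded orthogonal_matrix_sum_rows, rule_format])
  \<comment> \<open>Rows have norm one, so none is zero; \<open>p i\<close> picks a column with a
    nonzero entry.\<close>
  have "\<exists>b. Q $ i $ b \<noteq> 0" for i
  proof (rule ccontr)
    assume "\<not> (\<exists>b. Q $ i $ b \<noteq> 0)"
    then show False using rows[of i i] by simp
  qed
  then obtain p where p: "\<And>i. Q $ i $ p i \<noteq> 0"
    by metis
  have zero: "Q $ i $ b = 0" if "b \<noteq> p i" for i b
  proof (rule ccontr)
    assume "Q $ i $ b \<noteq> 0"
    \<comment> \<open>After cancelling the nonzero entries, \<open>eq\<close> makes both sides equal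
      to \<open>d' i\<close>.\<close>
    then have "d b = d (p i)"
      using eq[of i b] eq[of i "p i"] p[of i] by (metis mult.commute mult_right_cancel)
    then show False
      using that \<open>inj d\<close> by (simp add: inj_eq)
  qed
  have Q_eq: "Q $ i $ j = (if j = p i then Q $ i $ p i else 0)" for i j
    using zero by simp
  have rows_p: "Q $ i $ p i * Q $ j $ p i = (if i = j then 1 else 0)" for i j
  proof -
    have "(\<Sum>k\<in>UNIV. Q $ i $ k * Q $ j $ k)
        = (\<Sum>k\<in>UNIV. if k = p i then Q $ i $ p i * Q $ j $ p i else 0)"
      by (intro sum.cong) (auto simp: zero)
    then show ?thesis using rows[of i j] by simp
  qed
  \<comment> \<open>If \<open>p i = p j\<close>, the product in \<open>rows_p\<close> has two
    nonzero factors, so \<open>i = j\<close>. The case \<open>i = j\<close> of \<open>rows_p\<close>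
    gives the signs below.\<close>
  have "inj p"
    by (rule injI) (metis p rows_p mult_eq_0_iff)
  then have "bij p"
    by (simp add: bij_def finite_UNIV_inj_surj)
  moreover have "\<forall>i. Q $ i $ p i = 1 \<or> Q $ i $ p i = -1"
    using rows_p by (metis square_eq_1_iff)
  ultimately show ?thesis
    unfolding signed_permutation_matrices_iff
    by (intro exI[of _ p] exI[of _ "\<lambda>i. Q $ i $ p i"] conjI allI Q_eq) simp_all
qed

section \<open>Orthogonal matrices that keep the tensor reflectionally invariant\<close>

theorem theorem5p10:
  fixes T :: "'n::finite list \<Rightarrow> real" and r l :: nat
  assumes "r \<ge> 2" and "even r"
    and "T \<in> V_refl r"
    and "l = (r - 2) div 2"
    and "\<forall>j k. j \<noteq> k \<longrightarrow> contracted_diag l T j \<noteq> contracted_diag l T k"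
  shows "(\<forall>Q \<in> orthogonal_group. tensor_act Q T \<in> V_refl r \<longleftrightarrow> Q \<in> signed_permutation_matrices)
    \<and> {Q \<in> orthogonal_group. tensor_act Q T \<in> V_refl r} = signed_permutation_matrices"
proof -
  \<comment> \<open>As \<open>r\<close> is even, the division is exact: contracting \<open>l\<close>
    pairs leaves precisely two indices.\<close>
  have r: "r = 2 * l + 2"
    using assms(1,2,4) by (auto elim!: evenE)
  have "Q \<in> signed_permutation_matrices"
    if Q: "Q \<in> orthogonal_group" and QT: "tensor_act Q T \<in> V_refl r" for Q
  proof -
    have orth: "orthogonal_matrix Q"
      using Q by (simp add: orthogonal_group_def)
    define d where "d = contracted_diag l T"
    define d' where "d' = contracted_diag l (tensor_act Q T)"
    have T2: "contract_pairs l T [a, b] = (if a = b then d a else 0)" for a b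
      using contract_pairs_off_diagonal[of T l a b] assms(3) r
      by (simp add: d_def contracted_diag_def contract_pairs_def)
    \<comment> \<open>The left side is an entry of the transformed contraction of \<open>T\<close>.
      It is also the contraction of \<open>tensor_act Q T\<close>, which is diagonal by
      \<open>QT\<close>.\<close>
    have "(\<Sum>a\<in>UNIV. Q $ i $ a * Q $ j $ a * d a) = (if i = j then d' i else 0)" for i j
    proof -
      have "(\<Sum>a\<in>UNIV. Q $ i $ a * Q $ j $ a * d a) = tensor_act Q (contract_pairs l T) [i, j]"
        by (simp add: tensor_act_Cons T2 if_distrib[of "\<lambda>x. _ * x"] mult.assoc cong: if_cong)
      also have "\<dots> = contract_pairs l (tensor_act Q T) [i, j]"
        by (simp add: contract_pairs_tensor_act[OF orth])
      also have "\<dots> = (if i = j then d' i else 0)"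
        using contract_pairs_off_diagonal[of "tensor_act Q T" l i j] QT r
        by (simp add: d'_def contracted_diag_def contract_pairs_def)
      finally show ?thesis .
    qed
    moreover have "inj d"
      using assms(5) by (auto simp: d_def inj_def)
    ultimately show ?thesis
      using orthogonal_conj_diagonal_imp_signed_permutation[OF orth] by blast
  qed
  \<comment> \<open>Conversely, signed permutations preserve \<open>V_refl r\<close>; their
    orthogonality turns the equivalence into the equality of sets.\<close>
  then show ?thesis
    using tensor_act_signed_permutation_V_refl[OF _ assms(3)]
      signed_permutation_matrices_subset_orthogonal by blast
qed

end
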